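(* Let $A\subseteq\mathbb{N}$ satisfy $\operatorname{BD}(A)>0$. Then there exist infinite sets $B,C\subseteq\mathbb{N}$ and an integer $k\in\mathbb{Z}$ such that $B+C\subseteq A\cup(A+k)$.
   Context: $\mathbb{N}=\{1,2,3,\dots\}$. For $a,b\in\mathbb{N}$, $[a,b]=\{c\in\mathbb{N}: a\le c\le b\}$. For sets of integers, $B+C=\{b+c: b\in B,c\in C\}$ and $A+k=\{a+k:a\in A\}$. The (upper) Banach density of $A\subseteq\mathbb{N}$ is $\operatorname{BD}(A)=\lim_{n\to\infty}\sup_{m\in\mathbb{N}}\frac{|A\cap[m,m+n]|}{n}$. *)

theory Defs
  imports "HOL-Analysis.Analysis"
begin

text \<open>Natural numbers here are positive: subsets of \<open>\<nat>\<close> are sets of nat not containing 0.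
  Upper Banach density: BD(A) = lim_{n->oo} sup_{m>=1} |A \<inter> [m,m+n]| / n.\<close>

definition banach_density :: "nat set \<Rightarrow> real" where
  "banach_density A =
     lim (\<lambda>n. (SUP m\<in>{1..}. real (card (A \<inter> {m..m+n})) / real n))"

definition sumset :: "int set \<Rightarrow> int set \<Rightarrow> int set" where
  "sumset B C = {b + c | b c. b \<in> B \<and> c \<in> C}"

end

theory Submission
  imports Defs "HOL-Library.Ramsey" "HOL-Complex_Analysis.Great_Picard"
begin

text \<open>Let \<open>\<alpha>\<close> be the Banach density of \<open>A\<close>. By Fekete's lemma no long window has density much above \<open>\<alpha>\<close>,
  while windows \<open>J\<^sub>i\<close> of every length have density at least \<open>\<alpha>\<close>. By this upper bound an averaging argument
  gives translates \<open>A - c\<^sub>n\<close> whose density is close to \<open>\<alpha>\<close> on many \<open>J\<^sub>i\<close> at once; let \<open>R\<close> be a pointwise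
  limit of them. For a suitable \<open>l\<close>, again by the upper bound, \<open>A + [0,l)\<close> and \<open>R + [0,l)\<close> both have density
  at least 3/4 on the \<open>J\<^sub>i\<close>, so the sets \<open>E\<^sub>j = (A + [0,l) - c\<^sub>j) \<inter> (R + [0,l))\<close> have density bounded away
  from 0 there. Bergelson's intersectivity lemma yields a subsequence of the \<open>E\<^sub>j\<close> all of whose finite
  intersections are infinite. Since each element of \<open>R + [0,l)\<close> lies in all but finitely many \<open>A + [0,l) - c\<^sub>j\<close>,
  one can choose \<open>b\<^sub>i\<close> and \<open>c\<^sub>k\<close> alternately with \<open>b\<^sub>i + c\<^sub>k \<in> A + [0,l)\<close> for all \<open>i, k\<close>. Ramsey's theorem makes
  the shift in \<open>[0,l)\<close> depend only on whether \<open>i < k\<close> or \<open>i > k\<close>, so two shifts suffice.\<close>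

section \<open>Subadditivity and Banach density\<close>

lemma fekete:
  fixes u :: "nat \<Rightarrow> real"
  assumes nonneg: "\<And>n. 0 \<le> u n" and subadd: "\<And>m n. u (m + n) \<le> u m + u n"
  shows "(\<lambda>n. u n / n) \<longlonglongrightarrow> (INF n\<in>{1..}. u n / n)"
proof (rule order_tendstoI)
  let ?L = "INF n\<in>{1..}. u n / real n"
  have bdd: "bdd_below ((\<lambda>n. u n / real n) ` {1..})"
    by (rule bdd_belowI2[of _ 0]) (simp add: nonneg)
  fix a assume "a < ?L"
  have "a < u n / n" if "n \<ge> 1" for n :: nat
    using \<open>a < ?L\<close> cINF_lower[OF bdd, of n] that by fastforce
  then show "\<forall>\<^sub>F n in sequentially. a < u n / n"
    using eventually_sequentially by blast
next
  let ?L = "INF n\<in>{1..}. u n / real n"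
  fix a assume "?L < a"
  then obtain p where p: "p \<ge> 1" "u p / p < a"
    using cInf_lessD[of "(\<lambda>n. u n / real n) ` {1..}" a] by auto
  have mult: "u (q * p + r) \<le> q * u p + u r" for q r
  proof (induction q)
    case (Suc q)
    have "u (Suc q * p + r) \<le> u p + u (q * p + r)"
      using subadd[of p "q * p + r"] by (simp add: algebra_simps)
    with Suc show ?case by (simp add: algebra_simps)
  qed simp
  \<comment> \<open>Summing over all residues bounds \<open>u (n mod p)\<close> independently of
    \<open>n\<close>, so the remainder vanishes after division by \<open>n\<close>.\<close>
  define M where "M = (\<Sum>r<p. u r)"
  have bound: "u n / n \<le> u p / p + M / n" if "n \<ge> 1" for n :: nat
  proof -
    have "u n \<le> (n div p) * u p + u (n mod p)"
      using mult[of "n div p" "n mod p"] by simp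
    also have "u (n mod p) \<le> M"
      unfolding M_def using p nonneg by (intro member_le_sum) auto
    also have "real (n div p) * u p \<le> n / p * u p"
      by (intro mult_right_mono of_nat_div_le_of_nat nonneg)
    finally show ?thesis
      using that p by (simp add: field_simps)
  qed
  have "(\<lambda>n. u p / p + M / real n) \<longlonglongrightarrow> u p / p + 0"
    by (intro tendsto_intros lim_const_over_n)
  then have "\<forall>\<^sub>F n in sequentially. u p / p + M / real n < a"
    using p(2) by (intro order_tendstoD(2)) auto
  with eventually_ge_at_top[of 1] show "\<forall>\<^sub>F n in sequentially. u n / n < a"
    by eventually_elim (use bound in force)
qed

text \<open>Half-open windows split into consecutive ones, which makes this subadditive. Unlike in
  \<open>banach_density\<close>, the start 0 is allowed.\<close>

definition window_max :: "nat set \<Rightarrow> nat \<Rightarrow> nat" where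
  "window_max A n = Max (range (\<lambda>m. card (A \<inter> {m..<m + n})))"

lemma card_window_le:
  fixes A :: "nat set"
  shows "card (A \<inter> {m..<m + n}) \<le> n"
  using card_mono[of "{m..<m + n}" "A \<inter> {m..<m + n}"] by simp

lemma finite_window_counts:
  fixes A :: "nat set"
  shows "finite (range (\<lambda>m. card (A \<inter> {m..<m + n})))"
  by (rule finite_subset[of _ "{..n}"]) (use card_window_le in blast)+

lemma window_max_upper: "card (A \<inter> {m..<m + n}) \<le> window_max A n"
  unfolding window_max_def by (intro Max_ge finite_window_counts) auto

lemma window_max_attained: "\<exists>m. card (A \<inter> {m..<m + n}) = window_max A n"
  using Max_in[OF finite_window_counts[of A n]] unfolding window_max_def by fastforce

lemma window_max_add: "window_max A (m + n) \<le> window_max A m + window_max A n"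
proof -
  obtain x where x: "card (A \<inter> {x..<x + (m + n)}) = window_max A (m + n)"
    using window_max_attained by blast
  have "A \<inter> {x..<x + (m + n)} = A \<inter> {x..<x + m} \<union> A \<inter> {x + m..<x + m + n}"
    by auto
  then have "card (A \<inter> {x..<x + (m + n)}) \<le> card (A \<inter> {x..<x + m}) + card (A \<inter> {x + m..<x + m + n})"
    by (simp add: card_Un_le)
  also have "\<dots> \<le> window_max A m + window_max A n"
    by (intro add_mono window_max_upper)
  finally show ?thesis using x by simp
qed

text \<open>The closed interval has \<open>n + 1\<close> points, hence \<open>Suc n\<close>. A
  maximal window starting at 0 can be moved to start at 1 without losing an element of
  \<open>A\<close>.\<close>

lemma SUP_window_eq:
  assumes "0 \<notin> A"
  shows "(SUP m\<in>{1..}. real (card (A \<inter> {m..m + n})) / real n) = window_max A (Suc n) / n"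
proof (rule cSup_eq_maximum)
  have eq: "{m..m + n} = {m..<m + Suc n}" for m
    by auto
  obtain m where m: "card (A \<inter> {m..<m + Suc n}) = window_max A (Suc n)"
    using window_max_attained by blast
  have "\<exists>m\<ge>1. card (A \<inter> {m..<m + Suc n}) = window_max A (Suc n)"
  proof (cases "m = 0")
    case True
    have "A \<inter> {0..<Suc n} \<subseteq> A \<inter> {1..<1 + Suc n}"
      using assms by (auto simp: Suc_le_eq intro: gr0I)
    then have "card (A \<inter> {0..<Suc n}) \<le> card (A \<inter> {1..<1 + Suc n})"
      by (intro card_mono) auto
    then have "card (A \<inter> {1..<1 + Suc n}) = window_max A (Suc n)"
      using m True window_max_upper[of A 1 "Suc n"] by simp
    then show ?thesis by blast
  next
    case False
    with m show ?thesis by (intro exI[of _ m]) auto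
  qed
  then show "window_max A (Suc n) / n \<in> (\<lambda>m. real (card (A \<inter> {m..m + n})) / real n) ` {1..}"
    unfolding eq by force
  show "x \<le> window_max A (Suc n) / n"
    if "x \<in> (\<lambda>m. real (card (A \<inter> {m..m + n})) / real n) ` {1..}" for x
    using that window_max_upper[of A _ "Suc n"] unfolding eq
    by (auto intro!: divide_right_mono)
qed

lemma window_max_fekete:
  "(\<lambda>n. window_max A n / n) \<longlonglongrightarrow> (INF n\<in>{1..}. window_max A n / n)"
  by (rule fekete) (use window_max_add[of A] in \<open>simp_all flip: of_nat_add\<close>)

text \<open>The definition divides the count in \<open>n + 1\<close> points by \<open>n\<close>; the
  correcting factor \<open>1 + 1 / n\<close> tends to 1, so Fekete's limit is unchanged.\<close>

lemma banach_density_eq_INF: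
  assumes "0 \<notin> A"
  shows "banach_density A = (INF n\<in>{1..}. window_max A n / n)"
proof -
  let ?L = "INF n\<in>{1..}. window_max A n / real n"
  have "(\<lambda>n. window_max A (Suc n) / Suc n * (1 + 1 / n)) \<longlonglongrightarrow> ?L * (1 + 0)"
    by (intro tendsto_intros lim_const_over_n LIMSEQ_Suc[OF window_max_fekete])
  moreover have "window_max A (Suc n) / Suc n * (1 + 1 / n) = window_max A (Suc n) / n"
    if "n \<ge> 1" for n
  proof -
    have "1 + 1 / real n = Suc n / n"
      using that by (simp add: field_simps)
    then show ?thesis by simp
  qed
  ultimately have "(\<lambda>n. window_max A (Suc n) / real n) \<longlonglongrightarrow> ?L"
    by (subst tendsto_cong[where g = "\<lambda>n. window_max A (Suc n) / Suc n * (1 + 1 / n)"])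
       (auto simp: eventually_sequentially intro!: exI[of _ 1])
  then show ?thesis
    unfolding banach_density_def SUP_window_eq[OF assms] by (rule limI)
qed

lemma window_max_ge_density:
  assumes "0 \<notin> A"
  shows "banach_density A * n \<le> window_max A n"
proof (cases "n = 0")
  case False
  have "bdd_below ((\<lambda>n. window_max A n / real n) ` {1..})"
    by (rule bdd_belowI2[of _ 0]) simp
  then have "banach_density A \<le> window_max A n / n"
    unfolding banach_density_eq_INF[OF assms] using False by (intro cINF_lower) auto
  then show ?thesis using False by (simp add: field_simps)
qed simp

lemma window_max_eventually_le:
  assumes "0 \<notin> A" and "\<epsilon> > 0"
  shows "\<forall>\<^sub>F n in sequentially. window_max A n \<le> (banach_density A + \<epsilon>) * n"
proof -
  have "\<forall>\<^sub>F n in sequentially. window_max A n / n < banach_density A + \<epsilon>"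
    using window_max_fekete[of A] assms unfolding banach_density_eq_INF[OF assms(1)]
    by (intro order_tendstoD(2)) auto
  with eventually_ge_at_top[of 1] show ?thesis
    by eventually_elim (auto simp: field_simps)
qed

section \<open>Translates dense on many windows, and their limit\<close>

lemma card_translate_window:
  fixes S :: "nat set"
  shows "card (S \<inter> {m..<m + M}) \<le> d + e + card {y \<in> {m + e..<m + M}. y + d \<in> S}"
proof -
  let ?H = "{y \<in> {m + e..<m + M}. y + d \<in> S}"
  \<comment> \<open>Only points of \<open>S\<close> below \<open>m + d + e\<close> are lost; all
    others are hit from some \<open>y \<ge> m + e\<close>.\<close>
  have "S \<inter> {m..<m + M} \<subseteq> {m..<m + (d + e)} \<union> (\<lambda>y. y + d) ` ?H"
  proof
    fix a assume a: "a \<in> S \<inter> {m..<m + M}"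
    show "a \<in> {m..<m + (d + e)} \<union> (\<lambda>y. y + d) ` ?H"
    proof (cases "a < m + (d + e)")
      case False
      then show ?thesis
        using a by (intro UnI2 image_eqI[of _ _ "a - d"]) auto
    qed (use a in auto)
  qed
  then have "card (S \<inter> {m..<m + M}) \<le> card ({m..<m + (d + e)} \<union> (\<lambda>y. y + d) ` ?H)"
    by (intro card_mono) auto
  also have "\<dots> \<le> card {m..<m + (d + e)} + card ((\<lambda>y. y + d) ` ?H)"
    by (rule card_Un_le)
  also have "\<dots> \<le> d + e + card ?H"
    using card_image_le[of ?H "\<lambda>y. y + d"] by simp
  finally show ?thesis .
qed

text \<open>Averaging over translates: the mean density on window \<open>i\<close> is almost
  \<open>\<alpha>\<close> or more, and no translate exceeds
  \<open>\<alpha> + \<delta> / 2 ^ (i + 2)\<close>, so the mean shortfall from this ceiling is at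
  most about \<open>\<delta> / 2 ^ (i + 2)\<close>. The total over all windows is about
  \<open>\<delta> / 2\<close> whatever \<open>N\<close> is, whereas a bad window in every translate
  would force at least \<open>\<delta>\<close>.\<close>

lemma exists_good_translate:
  fixes A :: "nat set" and x L :: "nat \<Rightarrow> nat" and \<delta> \<alpha> :: real
  assumes "\<alpha> \<ge> 0" and dense: "\<And>n. \<alpha> * n \<le> window_max A n"
    and "\<delta> > 0"
    and le: "\<And>i. window_max A (L i) \<le> (\<alpha> + \<delta> / 2 ^ (i + 2)) * L i"
    and L: "\<And>i. L i > 0"
  shows "\<exists>c\<ge>c0. \<forall>i<N. (\<alpha> - \<delta>) * L i \<le> card (A \<inter> {c + x i..<c + x i + L i})"
proof (rule ccontr)
  assume "\<not> ?thesis"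
  then have bad: "\<exists>i<N. card (A \<inter> {c + x i..<c + x i + L i}) < (\<alpha> - \<delta>) * L i" if "c \<ge> c0" for c
    using that by force
  define \<epsilon> where "\<epsilon> i = \<delta> / 2 ^ (i + 2)" for i :: nat
  have \<epsilon>: "\<epsilon> i > 0" for i
    using \<open>\<delta> > 0\<close> by (simp add: \<epsilon>_def)
  have sum_\<epsilon>: "(\<Sum>i<n. \<epsilon> i) \<le> \<delta> / 2" for n
  proof -
    have "(\<Sum>i<n. \<epsilon> i) = \<delta> / 2 - \<delta> / 2 ^ (n + 1)"
      by (induction n) (auto simp: \<epsilon>_def field_simps)
    then show ?thesis using \<open>\<delta> > 0\<close> by simp
  qed
  \<comment> \<open>\<open>Y\<close> bounds the right ends of all \<open>N\<close> windows.
    \<open>M\<close> is so large that the boundary errors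
    \<open>\<delta> * c0 + N * (Y + c0)\<close> stay below \<open>\<delta> / 2 * M\<close>.\<close>
  define Y where "Y = (\<Sum>i<N. x i + L i)"
  define M where "M = nat \<lceil>2 * (\<delta> * c0 + N * (Y + c0)) / \<delta>\<rceil> + c0 + 1"
  obtain m where m: "card (A \<inter> {m..<m + M}) = window_max A M"
    using window_max_attained by blast
  \<comment> \<open>The candidates fill a window of maximal count; dropping its first
    \<open>c0\<close> points guarantees \<open>c \<ge> c0\<close>.\<close>
  define K where "K = {m + c0..<m + M}"
  have cardK: "card K = M - c0" "c0 \<le> M"
    by (auto simp: K_def M_def)
  define f where "f i c = card (A \<inter> {c + x i..<c + x i + L i})" for i c
  \<comment> \<open>The shortfall from the ceiling. Since it is nonnegative, other windows cannot
    cancel a bad one.\<close>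
  define s where "s i c = \<alpha> + \<epsilon> i - f i c / L i" for i c
  have s_nonneg: "0 \<le> s i c" for i c
  proof -
    have "real (f i c) \<le> (\<alpha> + \<epsilon> i) * L i"
      using le[of i] window_max_upper[of A "c + x i" "L i"] unfolding f_def \<epsilon>_def by linarith
    then show ?thesis
      using L[of i] by (simp add: s_def divide_le_eq)
  qed
  have hit: "\<alpha> * M - (Y + c0) \<le> card {c \<in> K. c + y \<in> A}" if "y < Y" for y
  proof -
    have "card (A \<inter> {m..<m + M}) \<le> y + c0 + card {c \<in> K. c + y \<in> A}"
      unfolding K_def by (rule card_translate_window)
    then show ?thesis
      using dense[of M] m that by simp
  qed
  have sum_f: "L i * (\<alpha> * M - (Y + c0)) \<le> (\<Sum>c\<in>K. f i c)" if "i < N" for i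
  proof -
    have Y: "x i + L i \<le> Y"
      unfolding Y_def using that by (intro member_le_sum) auto
    have fi: "f i c = card {y \<in> {x i..<x i + L i}. c + y \<in> A}" for c
    proof -
      have "A \<inter> {c + x i..<c + x i + L i} = (\<lambda>y. c + y) ` {y \<in> {x i..<x i + L i}. c + y \<in> A}"
      proof safe
        fix a assume "a \<in> A" "a \<in> {c + x i..<c + x i + L i}"
        then show "a \<in> (\<lambda>y. c + y) ` {y \<in> {x i..<x i + L i}. c + y \<in> A}"
          by (intro image_eqI[of _ _ "a - c"]) auto
      qed auto
      then show ?thesis
        by (simp add: f_def card_image)
    qed
    have "(\<Sum>c\<in>K. f i c) = (\<Sum>y\<in>{x i..<x i + L i}. card {c \<in> K. c + y \<in> A})"
      unfolding fi by (intro sum_multicount_gen) (auto simp: K_def)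
    moreover have "(\<Sum>y\<in>{x i..<x i + L i}. \<alpha> * M - (Y + c0)) \<le>
        (\<Sum>y\<in>{x i..<x i + L i}. real (card {c \<in> K. c + y \<in> A}))"
      using Y by (intro sum_mono hit) auto
    ultimately show ?thesis by simp
  qed
  have sum_s: "(\<Sum>c\<in>K. s i c) \<le> \<epsilon> i * M + (Y + c0)" if "i < N" for i
  proof -
    have "(\<Sum>c\<in>K. s i c) = (\<alpha> + \<epsilon> i) * card K - (\<Sum>c\<in>K. f i c) / L i"
      by (simp add: s_def sum_subtractf sum_divide_distrib)
    moreover have "\<alpha> * M - (Y + c0) \<le> (\<Sum>c\<in>K. f i c) / L i"
      using sum_f[OF that] L[of i] by (simp add: le_divide_eq mult.commute)
    moreover have "(\<alpha> + \<epsilon> i) * card K \<le> (\<alpha> + \<epsilon> i) * M"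
      using cardK \<open>\<alpha> \<ge> 0\<close> \<epsilon>[of i] by (intro mult_left_mono) auto
    ultimately show ?thesis by (simp add: algebra_simps)
  qed
  have "\<delta> \<le> (\<Sum>i<N. s i c)" if "c \<in> K" for c
  proof -
    obtain i where i: "i < N" "f i c < (\<alpha> - \<delta>) * L i"
      using bad[of c] \<open>c \<in> K\<close> by (auto simp: K_def f_def)
    have "\<delta> \<le> s i c"
    proof -
      have "f i c / L i < \<alpha> - \<delta>"
        using i(2) L[of i] by (simp add: pos_divide_less_eq)
      then show ?thesis
        using \<epsilon>[of i] by (simp add: s_def)
    qed
    also have "\<dots> \<le> (\<Sum>i<N. s i c)"
      using i(1) s_nonneg by (intro member_le_sum) auto
    finally show ?thesis .
  qed
  then have "\<delta> * card K \<le> (\<Sum>c\<in>K. \<Sum>i<N. s i c)"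
    using sum_mono[of K "\<lambda>_. \<delta>" "\<lambda>c. \<Sum>i<N. s i c"] by (simp add: mult.commute)
  also have "\<dots> = (\<Sum>i<N. \<Sum>c\<in>K. s i c)"
    by (rule sum.swap)
  also have "\<dots> \<le> (\<Sum>i<N. \<epsilon> i * M + (Y + c0))"
    by (intro sum_mono sum_s) auto
  also have "\<dots> = (\<Sum>i<N. \<epsilon> i) * M + N * (Y + c0)"
    by (simp add: sum.distrib sum_distrib_right)
  also have "\<dots> \<le> \<delta> / 2 * M + N * (Y + c0)"
    by (intro add_right_mono mult_right_mono sum_\<epsilon>) auto
  finally have "\<delta> / 2 * M \<le> \<delta> * c0 + N * (Y + c0)"
    using cardK by (simp add: of_nat_diff algebra_simps)
  moreover have "2 * (\<delta> * c0 + N * (Y + c0)) / \<delta> < M"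
    unfolding M_def using \<open>\<delta> > 0\<close> by linarith
  ultimately show False
    using \<open>\<delta> > 0\<close> by (simp add: divide_less_eq mult.commute)
qed

lemma translate_limit_window:
  fixes c :: "nat \<Rightarrow> nat"
  assumes "\<And>y. \<forall>\<^sub>F n in sequentially. c n + y \<in> A \<longleftrightarrow> y \<in> R"
  shows "\<forall>\<^sub>F n in sequentially. card (A \<inter> {c n + m..<c n + m + l}) = card (R \<inter> {m..<m + l})"
proof -
  have "\<forall>\<^sub>F n in sequentially. \<forall>y\<in>{m..<m + l}. c n + y \<in> A \<longleftrightarrow> y \<in> R"
    by (intro eventually_ball_finite) (use assms in auto)
  then show ?thesis
  proof eventually_elim
    case (elim n)
    have iff: "c n + y \<in> A \<longleftrightarrow> y \<in> R" if "m \<le> y" "y < m + l" for y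
      using elim that by simp
    have "A \<inter> {c n + m..<c n + m + l} = (\<lambda>y. c n + y) ` (R \<inter> {m..<m + l})"
    proof safe
      fix a assume "a \<in> A" "a \<in> {c n + m..<c n + m + l}"
      then show "a \<in> (\<lambda>y. c n + y) ` (R \<inter> {m..<m + l})"
        using iff[of "a - c n"] by (intro image_eqI[of _ _ "a - c n"]) auto
    qed (use iff in auto)
    then show ?case by (simp add: card_image)
  qed
qed

text \<open>The translates \<open>c n\<close> are chosen good for the first \<open>n\<close>
  windows. A pointwise limit along a subsequence inherits the bound on every window, since a window
  has only finitely many positions and is eventually among those treated.\<close>

lemma exists_translate_limit:
  fixes A :: "nat set" and x L :: "nat \<Rightarrow> nat" and \<beta> :: real
  assumes "\<And>N c0. \<exists>c\<ge>c0. \<forall>i<N. \<beta> * L i \<le> card (A \<inter> {c + x i..<c + x i + L i})"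
  shows "\<exists>c R. strict_mono c \<and> (\<forall>y. \<forall>\<^sub>F n in sequentially. c n + y \<in> A \<longleftrightarrow> y \<in> R) \<and>
    (\<forall>i. \<beta> * L i \<le> card (R \<inter> {x i..<x i + L i}))"
proof -
  define good where "good n c \<longleftrightarrow> (\<forall>i<n. \<beta> * L i \<le> card (A \<inter> {c + x i..<c + x i + L i}))"
    for n c :: nat
  have ex: "\<exists>c\<ge>c0. good n c" for n c0
    using assms unfolding good_def by blast
  have "\<exists>c. \<forall>n. good n (c n) \<and> c n < c (Suc n)"
  proof (rule dependent_nat_choice)
    fix c n
    show "\<exists>c'. good (Suc n) c' \<and> c < c'"
      using ex[of "Suc c" "Suc n"] by (auto simp: Suc_le_eq)
  qed (use ex in blast)
  then obtain c where c: "\<And>n. good n (c n)" "\<And>n. c n < c (Suc n)"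
    by blast
  have "strict_mono c"
    using c(2) by (simp add: strict_mono_Suc_iff)
  define f :: "nat \<Rightarrow> nat \<Rightarrow> real" where "f n y = of_bool (c n + y \<in> A)" for n y
  obtain k where k: "strict_mono k" "\<And>y. y \<in> UNIV \<Longrightarrow> \<exists>l. (\<lambda>n. f (k n) y) \<longlonglongrightarrow> l"
    using function_convergent_subsequence[where S = UNIV and f = f and M = 1] by (auto simp: f_def)
  define R where "R = {y. \<forall>\<^sub>F n in sequentially. c (k n) + y \<in> A}"
  have ev: "\<forall>\<^sub>F n in sequentially. c (k n) + y \<in> A \<longleftrightarrow> y \<in> R" for y
  proof -
    obtain l where "(\<lambda>n. f (k n) y) \<longlonglongrightarrow> l"
      using k(2) by blast
    then have l: "\<forall>\<^sub>F n in sequentially. dist (f (k n) y) l < 1 / 2"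
      by (rule tendstoD) simp
    \<comment> \<open>Values 0 or 1 within distance 1/2 of \<open>l\<close> are all 0 if
      \<open>l < 1 / 2\<close> and all 1 otherwise.\<close>
    show ?thesis
    proof (cases "l < 1 / 2")
      case True
      have "\<forall>\<^sub>F n in sequentially. c (k n) + y \<notin> A"
        using l by eventually_elim (use True in \<open>auto simp: f_def dist_real_def split: split_of_bool_asm\<close>)
      moreover from this have "y \<notin> R"
        unfolding R_def using eventually_happens'[OF sequentially_bot] eventually_conj by fastforce
      ultimately show ?thesis by simp
    next
      case False
      have "\<forall>\<^sub>F n in sequentially. c (k n) + y \<in> A"
        using l by eventually_elim (use False in \<open>auto simp: f_def dist_real_def split: split_of_bool_asm\<close>)
      then show ?thesis
        by (simp add: R_def)
    qed
  qed
  have "\<beta> * L i \<le> card (R \<inter> {x i..<x i + L i})" for i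
  proof -
    have "\<forall>\<^sub>F n in sequentially. \<beta> * L i \<le> card (R \<inter> {x i..<x i + L i})"
      using translate_limit_window[of "\<lambda>n. c (k n)" A R "x i" "L i", OF ev] eventually_gt_at_top[of i]
    proof eventually_elim
      case (elim n)
      have "i < k n"
        using elim(2) seq_suble[OF k(1), of n] by simp
      then have "\<beta> * L i \<le> card (A \<inter> {c (k n) + x i..<c (k n) + x i + L i})"
        using c(1)[of "k n"] unfolding good_def by blast
      then show ?case
        unfolding elim(1) .
    qed
    then show ?thesis by simp
  qed
  then show ?thesis
    using ev strict_mono_o[OF \<open>strict_mono c\<close> k(1)]
    by (intro exI[of _ "c \<circ> k"] exI[of _ R]) simp
qed

section \<open>Fattened sets and their density\<close>

definition fatten :: "nat \<Rightarrow> nat set \<Rightarrow> nat set" where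
  "fatten l R = {r + t | r t. r \<in> R \<and> t < l}"

text \<open>Double counting of the pairs with \<open>r \<le> z < r + l\<close>: each
  \<open>r\<close> away from the right end has \<open>l\<close> partners in the fattened set, and
  each \<open>z\<close> has at most \<open>D\<close>, since they lie in one window of length
  \<open>l\<close>. The term \<open>l * l\<close> pays for the at most \<open>l\<close> excluded
  \<open>r\<close>.\<close>

lemma fatten_card:
  assumes D: "\<And>m. card (R \<inter> {m..<m + l}) \<le> D"
  shows "card (R \<inter> {x..<x + L}) * l \<le> card (fatten l R \<inter> {x..<x + L}) * D + l * l"
proof -
  let ?T = "fatten l R \<inter> {x..<x + L}"
  define S where "S = {r \<in> R \<inter> {x..<x + L}. r + l \<le> x + L}"
  have fin: "finite S" by (simp add: S_def)
  have "R \<inter> {x..<x + L} \<subseteq> S \<union> {x + L - l..<x + L}"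
    by (auto simp: S_def)
  then have "card (R \<inter> {x..<x + L}) \<le> card (S \<union> {x + L - l..<x + L})"
    using fin by (intro card_mono) auto
  also have "\<dots> \<le> card S + l"
    using card_Un_le[of S "{x + L - l..<x + L}"] by simp
  finally have "card (R \<inter> {x..<x + L}) * l \<le> card S * l + l * l"
    by (metis add_mult_distrib mult_le_mono1)
  also have "card S * l = (\<Sum>r\<in>S. card {z \<in> ?T. r \<le> z \<and> z < r + l})"
  proof -
    have "card {z \<in> ?T. r \<le> z \<and> z < r + l} = l" if "r \<in> S" for r
    proof -
      have "z \<in> fatten l R" if "r \<le> z" "z < r + l" for z
        unfolding fatten_def using that \<open>r \<in> S\<close>
        by (intro CollectI exI[of _ r] exI[of _ "z - r"]) (auto simp: S_def)
      then have "{z \<in> ?T. r \<le> z \<and> z < r + l} = {r..<r + l}"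
        using that by (auto simp: S_def)
      then show ?thesis by simp
    qed
    then show ?thesis by simp
  qed
  also have "\<dots> = (\<Sum>z\<in>?T. card {r \<in> S. r \<le> z \<and> z < r + l})"
    using fin by (intro sum_multicount_gen) auto
  also have "\<dots> \<le> (\<Sum>z\<in>?T. D)"
  proof (rule sum_mono)
    fix z
    \<comment> \<open>For \<open>z + 1 < l\<close> the truncated subtraction gives the window
      \<open>{0..<l}\<close>, which still contains every \<open>r \<le> z\<close>.\<close>
    have "card {r \<in> S. r \<le> z \<and> z < r + l} \<le> card (R \<inter> {z + 1 - l..<z + 1 - l + l})"
      by (intro card_mono) (auto simp: S_def)
    then show "card {r \<in> S. r \<le> z \<and> z < r + l} \<le> D"
      using D[of "z + 1 - l"] by linarith
  qed
  finally show ?thesis by simp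
qed

text \<open>Dividing the bound of \<open>fatten_card\<close> by \<open>l\<close> leaves
  \<open>9 / 10 * \<alpha> * L - l \<le> 11 / 10 * \<alpha> * T\<close> for the count
  \<open>T\<close> of the fattened set. The left side is at least
  \<open>33 / 40 * \<alpha> * L\<close>, which is \<open>11 / 10 * \<alpha>\<close> times
  \<open>3 / 4 * L\<close>.\<close>

lemma fatten_dense:
  fixes \<alpha> :: real
  assumes "\<alpha> > 0" "l > 0" and D: "\<And>m. card (R \<inter> {m..<m + l}) \<le> 11 / 10 * \<alpha> * l"
    and dense: "9 / 10 * \<alpha> * L \<le> card (R \<inter> {x..<x + L})" and "40 * l \<le> 3 * \<alpha> * L"
  shows "3 / 4 * L \<le> card (fatten l R \<inter> {x..<x + L})"
proof -
  let ?T = "real (card (fatten l R \<inter> {x..<x + L}))"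
  define d where "d = nat \<lfloor>11 / 10 * \<alpha> * l\<rfloor>"
  have "card (R \<inter> {x..<x + L}) * l \<le> card (fatten l R \<inter> {x..<x + L}) * d + l * l"
    using D by (intro fatten_card) (simp add: d_def le_nat_floor)
  then have "real (card (R \<inter> {x..<x + L}) * l) \<le> real (card (fatten l R \<inter> {x..<x + L}) * d + l * l)"
    by (rule of_nat_mono)
  then have "real (card (R \<inter> {x..<x + L})) * l \<le> ?T * d + l * l"
    by simp
  also have "?T * d \<le> ?T * (11 / 10 * \<alpha> * l)"
    unfolding d_def using assms by (intro mult_left_mono of_nat_floor) auto
  finally have "real (card (R \<inter> {x..<x + L})) * l \<le> (?T * (11 / 10 * \<alpha>) + l) * l"
    by (simp add: algebra_simps)
  then have "real (card (R \<inter> {x..<x + L})) \<le> ?T * (11 / 10 * \<alpha>) + l"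
    using \<open>l > 0\<close> by simp
  then have "(3 / 4 * L) * (11 / 10 * \<alpha>) \<le> ?T * (11 / 10 * \<alpha>)"
    using dense assms(5) by (simp add: algebra_simps)
  then show ?thesis
    using \<open>\<alpha> > 0\<close> by simp
qed

section \<open>Bonferroni's inequality and Bergelson's intersectivity lemma\<close>

lemma bonferroni:
  assumes "finite I" and "\<And>i. i \<in> I \<Longrightarrow> finite (X i)"
  shows "(\<Sum>i\<in>I. card (X i)) \<le> card (\<Union>i\<in>I. X i) + (\<Sum>i\<in>I. \<Sum>j\<in>I - {i}. card (X i \<inter> X j))"
  using assms
proof (induction I rule: finite_induct)
  case (insert a I)
  let ?U = "\<Union>i\<in>I. X i"
  have "card (X a) + card ?U = card (X a \<union> ?U) + card (X a \<inter> ?U)"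
    using insert.prems insert.hyps(1) by (intro card_Un_Int finite_UN_I) auto
  moreover have "card (X a \<inter> ?U) \<le> (\<Sum>j\<in>I. card (X a \<inter> X j))"
    using card_UN_le[OF insert.hyps(1), of "\<lambda>j. X a \<inter> X j"] by (simp only: Int_UN_distrib)
  moreover have "(\<Sum>i\<in>I. \<Sum>j\<in>I - {i}. card (X i \<inter> X j))
      \<le> (\<Sum>i\<in>I. \<Sum>j\<in>insert a I - {i}. card (X i \<inter> X j))"
    using insert.hyps by (intro sum_mono sum_mono2) auto
  moreover have "insert a I - {a} = I"
    using insert.hyps by auto
  moreover have "(\<Sum>i\<in>I. card (X i)) \<le> card ?U + (\<Sum>i\<in>I. \<Sum>j\<in>I - {i}. card (X i \<inter> X j))"
    using insert.prems by (intro insert.IH) auto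
  ultimately show ?case
    using insert.hyps by simp
qed simp

text \<open>Bonferroni's inequality inside \<open>J n\<close>, divided by \<open>card (J n)\<close>
  and passed to the limit; the leading 1 is the trivial bound for the union.\<close>

lemma bonferroni_density:
  fixes \<mu> :: "nat set \<Rightarrow> real"
  assumes J: "\<And>i. finite (J i) \<and> J i \<noteq> {}"
    and lim: "\<And>F. finite F \<Longrightarrow> (\<lambda>i. card (J i \<inter> (\<Inter>j\<in>F. E j)) / card (J i)) \<longlonglongrightarrow> \<mu> F"
    and "finite F" "finite I"
  shows "(\<Sum>i\<in>I. \<mu> (insert i F)) \<le> 1 + (\<Sum>i\<in>I. \<Sum>j\<in>I - {i}. \<mu> (insert i (insert j F)))"
proof (rule LIMSEQ_le)
  let ?d = "\<lambda>n F. card (J n \<inter> (\<Inter>j\<in>F. E j)) / card (J n)"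
  show "(\<lambda>n. \<Sum>i\<in>I. ?d n (insert i F)) \<longlonglongrightarrow> (\<Sum>i\<in>I. \<mu> (insert i F))"
    using assms by (intro tendsto_sum lim) auto
  show "(\<lambda>n. 1 + (\<Sum>i\<in>I. \<Sum>j\<in>I - {i}. ?d n (insert i (insert j F))))
     \<longlonglongrightarrow> 1 + (\<Sum>i\<in>I. \<Sum>j\<in>I - {i}. \<mu> (insert i (insert j F)))"
    using assms by (intro tendsto_add tendsto_const tendsto_sum lim) auto
  have "(\<Sum>i\<in>I. ?d n (insert i F)) \<le> 1 + (\<Sum>i\<in>I. \<Sum>j\<in>I - {i}. ?d n (insert i (insert j F)))" for n
  proof -
    define X where "X i = J n \<inter> (\<Inter>j\<in>insert i F. E j)" for i
    have X2: "J n \<inter> (\<Inter>k\<in>insert i (insert j F). E k) = X i \<inter> X j" for i j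
      unfolding X_def by auto
    have "(\<Sum>i\<in>I. card (X i)) \<le> card (\<Union>i\<in>I. X i) + (\<Sum>i\<in>I. \<Sum>j\<in>I - {i}. card (X i \<inter> X j))"
      using assms by (intro bonferroni) (auto simp: X_def)
    also have "card (\<Union>i\<in>I. X i) \<le> card (J n)"
      using J by (intro card_mono) (auto simp: X_def)
    finally have "real (\<Sum>i\<in>I. card (X i)) / card (J n) \<le>
        real (card (J n) + (\<Sum>i\<in>I. \<Sum>j\<in>I - {i}. card (X i \<inter> X j))) / card (J n)"
      by (intro divide_right_mono of_nat_mono) simp_all
    moreover have "card (J n) > 0"
      using J by (simp add: card_gt_0_iff)
    ultimately have "(\<Sum>i\<in>I. card (X i) / card (J n)) \<le>
        1 + (\<Sum>i\<in>I. \<Sum>j\<in>I - {i}. card (X i \<inter> X j) / card (J n))"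
      by (simp add: add_divide_distrib sum_divide_distrib)
    then show ?thesis
      unfolding X2 by (simp add: X_def)
  qed
  then show "\<exists>N. \<forall>n\<ge>N. (\<Sum>i\<in>I. ?d n (insert i F)) \<le> 1 + (\<Sum>i\<in>I. \<Sum>j\<in>I - {i}. ?d n (insert i (insert j F)))"
    by blast
qed

text \<open>Among the pairs of an infinite set, Ramsey's theorem makes either all intersections large
  or all of them small; Bonferroni's inequality excludes the latter.\<close>

lemma intersective_step:
  fixes \<mu> :: "nat set \<Rightarrow> real"
  assumes bonf: "\<And>I. finite I \<Longrightarrow>
      (\<Sum>i\<in>I. \<mu> (insert i F)) \<le> 1 + (\<Sum>i\<in>I. \<Sum>j\<in>I - {i}. \<mu> (insert i (insert j F)))"
    and T: "infinite T" "\<And>i. i \<in> T \<Longrightarrow> \<delta> \<le> \<mu> (insert i F)" and "\<delta> > 0"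
  shows "\<exists>Y\<subseteq>T. infinite Y \<and> (\<exists>\<delta>'>0. \<forall>i\<in>Y. \<forall>j\<in>Y. i \<noteq> j \<longrightarrow> \<delta>' \<le> \<mu> (insert i (insert j F)))"
proof -
  \<comment> \<open>A one-element \<open>I\<close> has no pairs, so \<open>bonf\<close> bounds
    \<open>\<mu>\<close> by 1. This absorbs the rounding in
    \<open>N \<le> 3 / \<delta>\<close>.\<close>
  have small: "\<delta> \<le> 1"
  proof -
    obtain t where "t \<in> T"
      using infinite_imp_nonempty[OF T(1)] by blast
    then show ?thesis
      using bonf[of "{t}"] T(2)[of t] by simp
  qed
  \<comment> \<open>Tuned to \<open>2 \<le> N * \<delta> \<le> 3\<close>: if all pairs were below
    \<open>\<delta>'\<close>, Bonferroni's inequality would give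
    \<open>N * \<delta> \<le> 1 + 9 / 16 < 2\<close>.\<close>
  define \<delta>' where "\<delta>' = \<delta>\<^sup>2 / 16"
  define f :: "nat set \<Rightarrow> nat" where "f P = of_bool (\<mu> (P \<union> F) < \<delta>')" for P
  obtain Y t where Y: "Y \<subseteq> T" "infinite Y" "t < 2" "\<And>i j. i \<in> Y \<Longrightarrow> j \<in> Y \<Longrightarrow> i \<noteq> j \<Longrightarrow> f {i, j} = t"
  proof -
    have "\<forall>x\<in>T. \<forall>y\<in>T. x \<noteq> y \<longrightarrow> f {x, y} < 2"
      by (simp add: f_def)
    from Ramsey2[OF T(1) this] show ?thesis
      using that by blast
  qed
  show ?thesis
  proof (cases "t = 0")
    case True
    then have "\<delta>' \<le> \<mu> (insert i (insert j F))" if "i \<in> Y" "j \<in> Y" "i \<noteq> j" for i j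
      using Y(4)[OF that] by (simp add: f_def split: if_splits)
    then show ?thesis
      using Y \<open>\<delta> > 0\<close> by (intro exI[of _ Y] conjI exI[of _ \<delta>']) (auto simp: \<delta>'_def)
  next
    case False
    have lt: "\<mu> (insert i (insert j F)) < \<delta>'" if "i \<in> Y" "j \<in> Y" "i \<noteq> j" for i j
      by (rule ccontr) (use Y(4)[OF that] False in \<open>simp add: f_def\<close>)
    define N where "N = nat \<lceil>2 / \<delta>\<rceil>"
    have "1 \<le> 1 / \<delta>" "0 \<le> 2 / \<delta>"
      using \<open>\<delta> > 0\<close> small by auto
    then have N: "2 / \<delta> \<le> N" "N \<le> 3 / \<delta>"
      unfolding N_def by linarith+
    obtain I where I: "I \<subseteq> Y" "finite I" "card I = N"
      using infinite_arbitrarily_large[OF Y(2)] by blast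
    have "N * \<delta> \<le> (\<Sum>i\<in>I. \<mu> (insert i F))"
      using sum_mono[of I "\<lambda>_. \<delta>" "\<lambda>i. \<mu> (insert i F)"] T I Y by auto
    also have "\<dots> \<le> 1 + (\<Sum>i\<in>I. \<Sum>j\<in>I - {i}. \<mu> (insert i (insert j F)))"
      by (rule bonf) (fact I)
    also have "(\<Sum>i\<in>I. \<Sum>j\<in>I - {i}. \<mu> (insert i (insert j F))) \<le> (\<Sum>i\<in>I. \<Sum>j\<in>I - {i}. \<delta>')"
      using lt I by (intro sum_mono less_imp_le) auto
    also have "\<dots> \<le> (\<Sum>i\<in>I. \<Sum>j\<in>I. \<delta>')"
      using I by (intro sum_mono sum_mono2) (auto simp: \<delta>'_def)
    also have "\<dots> = (N * \<delta>)\<^sup>2 / 16"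
      using I by (simp add: \<delta>'_def power2_eq_square)
    also have "\<dots> \<le> 3\<^sup>2 / 16"
      using N \<open>\<delta> > 0\<close> by (intro divide_right_mono power_mono) (auto simp: field_simps)
    finally have "N * \<delta> < 2" by (simp add: power2_eq_square)
    then show ?thesis
      using N \<open>\<delta> > 0\<close> by (simp add: field_simps)
  qed
qed

text \<open>Along one subsequence of \<open>J\<close> the densities of all finite intersections have
  limits \<open>\<mu>\<close>. Indices are then chosen one by one: the finite set \<open>F\<close>
  of chosen ones is kept with an infinite reservoir \<open>T\<close>, each element of which extends
  \<open>F\<close> with \<open>\<mu>\<close> uniformly positive.\<close>

lemma intersective_subsequence:
  fixes J :: "nat \<Rightarrow> 'a set" and \<delta> :: real
  assumes J: "\<And>i. finite (J i) \<and> J i \<noteq> {}"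
    and "\<delta> > 0"
    and dense: "\<And>j. \<forall>\<^sub>F i in sequentially. \<delta> * card (J i) \<le> card (J i \<inter> E j)"
  shows "\<exists>r. strict_mono (r :: nat \<Rightarrow> nat) \<and>
    (\<forall>n. \<exists>\<eta>>(0::real). \<exists>\<^sub>F i in sequentially. \<eta> * card (J i) \<le> card (J i \<inter> (\<Inter>k<n. E (r k))))"
proof -
  define d where "d i F = real (card (J i \<inter> (\<Inter>j\<in>F. E j))) / card (J i)" for i F
  have J0: "card (J i) > 0" for i
    using J by (simp add: card_gt_0_iff)
  have "norm (d i F) \<le> 1" for i F
    using J J0[of i] by (auto simp: d_def divide_le_eq intro: card_mono)
  \<comment> \<open>There are only countably many finite sets of indices, so one subsequence serves
    them all.\<close>
  then obtain s where s: "strict_mono s"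
      "\<And>F. F \<in> Collect finite \<Longrightarrow> \<exists>l. (\<lambda>i. d (s i) F) \<longlonglongrightarrow> l"
    using function_convergent_subsequence[OF countable_Collect_finite, of d 1] by blast
  define \<mu> where "\<mu> F = lim (\<lambda>i. d (s i) F)" for F
  have lim: "(\<lambda>i. d (s i) F) \<longlonglongrightarrow> \<mu> F" if "finite F" for F
    using s(2)[of F] that by (simp add: \<mu>_def convergent_def flip: convergent_LIMSEQ_iff)
  have bonf: "(\<Sum>i\<in>I. \<mu> (insert i F)) \<le> 1 + (\<Sum>i\<in>I. \<Sum>j\<in>I - {i}. \<mu> (insert i (insert j F)))"
    if "finite F" "finite I" for F I
    by (rule bonferroni_density[of "\<lambda>i. J (s i)" E \<mu>]) (use J lim that in \<open>auto simp: d_def\<close>)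
  define good where "good F T \<longleftrightarrow> finite F \<and> infinite T \<and> (\<exists>\<delta>>0. \<forall>i\<in>T. \<delta> \<le> \<mu> (insert i F))"
    for F T :: "nat set"
  have "\<delta> \<le> \<mu> {i}" for i
  proof (rule tendsto_lowerbound[OF lim])
    show "\<forall>\<^sub>F k in sequentially. \<delta> \<le> d (s k) {i}"
      using eventually_subseq[OF s(1) dense[of i]] J0 by (simp add: d_def field_simps)
  qed auto
  then have good0: "good {} UNIV"
    using \<open>\<delta> > 0\<close> by (auto simp: good_def)
  have step: "\<exists>j\<in>T. \<exists>T'\<subseteq>T \<inter> {j<..}. good (insert j F) T'" if g: "good F T" for F T
  proof -
    obtain \<delta>\<^sub>F where \<delta>\<^sub>F: "\<delta>\<^sub>F > 0" "\<And>i. i \<in> T \<Longrightarrow> \<delta>\<^sub>F \<le> \<mu> (insert i F)"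
      and fin: "finite F" and inf: "infinite T"
      using g unfolding good_def by blast
    obtain Y \<delta>' where Y: "Y \<subseteq> T" "infinite Y" "\<delta>' > 0"
        "\<And>i j. i \<in> Y \<Longrightarrow> j \<in> Y \<Longrightarrow> i \<noteq> j \<Longrightarrow> \<delta>' \<le> \<mu> (insert i (insert j F))"
      using intersective_step[OF bonf[OF fin] inf \<delta>\<^sub>F(2,1)] by blast
    \<comment> \<open>Fixing one member \<open>j\<close> turns the bound on pairs into a bound on
      extensions of \<open>insert j F\<close> by single later members.\<close>
    obtain j where "j \<in> Y"
      using infinite_imp_nonempty[OF Y(2)] by blast
    have "Y = (Y \<inter> {j<..}) \<union> (Y \<inter> {..j})"
      by auto
    then have "infinite (Y \<inter> {j<..})"
      using Y(2) by (metis finite_Int finite_Un finite_atMost)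
    then have "good (insert j F) (Y \<inter> {j<..})"
      using Y g \<open>j \<in> Y\<close> by (auto simp: good_def intro!: exI[of _ \<delta>'])
    then show ?thesis
      using Y \<open>j \<in> Y\<close> by blast
  qed
  have "\<exists>f. f 0 = ({}, UNIV) \<and>
      (\<forall>n. good (fst (f n)) (snd (f n)) \<and>
        (\<exists>j\<in>snd (f n). fst (f (Suc n)) = insert j (fst (f n)) \<and> snd (f (Suc n)) \<subseteq> snd (f n) \<inter> {j<..}))"
  proof -
    \<comment> \<open>The conjunct with \<open>n = 0\<close> pins the initial pair, which
      \<open>dependent_nat_choice\<close> leaves open.\<close>
    have "\<exists>f. \<forall>n. (good (fst (f n)) (snd (f n)) \<and> (n = 0 \<longrightarrow> f n = ({}, UNIV))) \<and>
        (\<exists>j\<in>snd (f n). fst (f (Suc n)) = insert j (fst (f n)) \<and> snd (f (Suc n)) \<subseteq> snd (f n) \<inter> {j<..})"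
    proof (rule dependent_nat_choice)
      fix x :: "nat set \<times> nat set" and n :: nat
      assume "good (fst x) (snd x) \<and> (n = 0 \<longrightarrow> x = ({}, UNIV))"
      then show "\<exists>y. (good (fst y) (snd y) \<and> (Suc n = 0 \<longrightarrow> y = ({}, UNIV))) \<and>
        (\<exists>j\<in>snd x. fst y = insert j (fst x) \<and> snd y \<subseteq> snd x \<inter> {j<..})"
        using step[of "fst x" "snd x"] by fastforce
    qed (use good0 in auto)
    then obtain f where "\<forall>n. (good (fst (f n)) (snd (f n)) \<and> (n = 0 \<longrightarrow> f n = ({}, UNIV))) \<and>
        (\<exists>j\<in>snd (f n). fst (f (Suc n)) = insert j (fst (f n)) \<and> snd (f (Suc n)) \<subseteq> snd (f n) \<inter> {j<..})" ..
    then show ?thesis by (intro exI[of _ f]) simp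
  qed
  then obtain f where f0: "f 0 = ({}, UNIV)"
      and f: "\<forall>n. good (fst (f n)) (snd (f n)) \<and>
        (\<exists>j\<in>snd (f n). fst (f (Suc n)) = insert j (fst (f n)) \<and> snd (f (Suc n)) \<subseteq> snd (f n) \<inter> {j<..})"
    by (elim exE conjE)
  have good: "good (fst (f n)) (snd (f n))" for n
    using f by simp
  have "\<forall>n. \<exists>j. j \<in> snd (f n) \<and> fst (f (Suc n)) = insert j (fst (f n)) \<and>
      snd (f (Suc n)) \<subseteq> snd (f n) \<inter> {j<..}"
    using f unfolding Bex_def by (intro allI) simp
  from choice[OF this] obtain r where r: "\<And>n. r n \<in> snd (f n)"
      "\<And>n. fst (f (Suc n)) = insert (r n) (fst (f n))"
      "\<And>n. snd (f (Suc n)) \<subseteq> snd (f n) \<inter> {r n<..}"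
    by (elim exE) blast
  have "r n < r (Suc n)" for n
    using r(1)[of "Suc n"] r(3)[of n] by auto
  then have "strict_mono r"
    by (simp add: strict_mono_Suc_iff)
  moreover have "\<exists>\<eta>>(0::real). \<exists>\<^sub>F i in sequentially. \<eta> * card (J i) \<le> card (J i \<inter> (\<Inter>k<n. E (r k)))" for n
  proof -
    have F: "fst (f n) = r ` {..<n}" for n
      by (induction n) (simp_all add: f0 r(2) lessThan_Suc)
    \<comment> \<open>\<open>good\<close> bounds \<open>\<mu>\<close> only after an extension of
      \<open>F\<close>, so \<open>r n\<close> is added; the intersection over \<open>k < n\<close>
      is at least as large.\<close>
    obtain \<eta> where \<eta>: "\<eta> > 0" "\<eta> \<le> \<mu> (r ` {..<Suc n})"
      using good[of n] r(1)[of n] unfolding good_def F lessThan_Suc by auto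
    have "\<forall>\<^sub>F i in sequentially. \<eta> / 2 < d (s i) (r ` {..<Suc n})"
      using \<eta> by (intro order_tendstoD(1)[OF lim]) auto
    then have "\<forall>\<^sub>F i in sequentially. \<eta> / 2 * card (J (s i)) \<le> card (J (s i) \<inter> (\<Inter>k<n. E (r k)))"
    proof eventually_elim
      case (elim i)
      have "card (J (s i) \<inter> (\<Inter>j\<in>r ` {..<Suc n}. E j)) \<le> card (J (s i) \<inter> (\<Inter>k<n. E (r k)))"
        using J by (intro card_mono) auto
      then show ?case
        using elim J0[of "s i"] by (simp add: d_def field_simps)
    qed
    then have "\<exists>\<^sub>F i in sequentially. \<eta> / 2 * card (J i) \<le> card (J i \<inter> (\<Inter>k<n. E (r k)))"
      unfolding frequently_sequentially eventually_sequentially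
      by (metis s(1) seq_suble le_trans nat_le_linear)
    then show ?thesis
      using \<eta>(1) by (intro exI[of _ "\<eta> / 2"] conjI) simp_all
  qed
  ultimately show ?thesis by blast
qed

section \<open>Alternating choice and reduction to two shifts\<close>

lemma interleaved_sequences:
  fixes P :: "nat \<Rightarrow> nat \<Rightarrow> bool"
  assumes ev: "\<And>b. b \<in> X \<Longrightarrow> \<forall>\<^sub>F j in sequentially. P b j"
    and inf: "\<And>m. infinite {b \<in> X. \<forall>j<m. P b j}"
  shows "\<exists>(b :: nat \<Rightarrow> nat) (j :: nat \<Rightarrow> nat). strict_mono b \<and> strict_mono j \<and> (\<forall>i k. P (b i) (j k))"
proof -
  \<comment> \<open>The invariant covers all of \<open>X\<close> up to the current \<open>b\<close>,
    and each new \<open>b\<close> respects all indices up to the current \<open>j\<close>; so no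
    history has to be carried.\<close>
  define good where "good x \<longleftrightarrow> fst x \<in> X \<and> (\<forall>b\<in>X. b \<le> fst x \<longrightarrow> P b (snd x))" for x
  have next_j: "\<exists>j>j0. \<forall>b'\<in>X. b' \<le> b \<longrightarrow> P b' j" for b j0
  proof -
    have "\<forall>\<^sub>F j in sequentially. \<forall>b'\<in>X \<inter> {..b}. P b' j"
      by (intro eventually_ball_finite) (use ev in auto)
    with eventually_gt_at_top[of j0] have "\<forall>\<^sub>F j in sequentially. j > j0 \<and> (\<forall>b'\<in>X \<inter> {..b}. P b' j)"
      by eventually_elim auto
    then show ?thesis
      by (auto dest!: eventually_happens'[OF sequentially_bot])
  qed
  have next_b: "\<exists>b>b0. b \<in> X \<and> (\<forall>j\<le>j0. P b j)" for b0 j0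
    using inf[of "Suc j0"] unfolding infinite_nat_iff_unbounded by (auto simp: less_Suc_eq_le)
  have "\<exists>f. \<forall>n. good (f n) \<and> fst (f n) < fst (f (Suc n)) \<and> snd (f n) < snd (f (Suc n)) \<and>
      (\<forall>j\<le>snd (f n). P (fst (f (Suc n))) j)"
  proof (rule dependent_nat_choice)
    show "\<exists>x. good x"
      using next_b next_j unfolding good_def by (metis fst_conv snd_conv)
    fix x :: "nat \<times> nat" and n :: nat
    obtain b where b: "b > fst x" "b \<in> X" "\<forall>j\<le>snd x. P b j"
      using next_b by blast
    obtain j where "j > snd x" "\<forall>b'\<in>X. b' \<le> b \<longrightarrow> P b' j"
      using next_j by blast
    with b show "\<exists>y. good y \<and> fst x < fst y \<and> snd x < snd y \<and> (\<forall>j\<le>snd x. P (fst y) j)"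
      by (intro exI[of _ "(b, j)"]) (simp add: good_def)
  qed
  then obtain f where f: "\<And>n. good (f n)" "\<And>n. fst (f n) < fst (f (Suc n))"
      "\<And>n. snd (f n) < snd (f (Suc n))" "\<And>n j. j \<le> snd (f n) \<Longrightarrow> P (fst (f (Suc n))) j"
    by blast
  have b: "strict_mono (\<lambda>n. fst (f n))" and j: "strict_mono (\<lambda>n. snd (f n))"
    using f by (simp_all add: strict_mono_Suc_iff)
  have "P (fst (f i)) (snd (f k))" for i k
  proof (cases "i \<le> k")
    case True
    then have "fst (f i) \<le> fst (f k)"
      using strict_mono_mono[OF b] by (simp add: mono_def)
    then show ?thesis
      using f(1)[of i] f(1)[of k] by (simp add: good_def)
  next
    case False
    then obtain n where n: "i = Suc n" "k \<le> n"
      by (cases i) auto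
    then have "snd (f k) \<le> snd (f n)"
      using strict_mono_mono[OF j] by (simp add: mono_def)
    then show ?thesis
      using f(4) n by simp
  qed
  with b j show ?thesis
    by (intro exI[of _ "\<lambda>n. fst (f n)"] exI[of _ "\<lambda>n. snd (f n)"]) simp
qed

text \<open>On a homogeneous set of indices the shift is a constant \<open>t\<close> for
  \<open>i < k\<close> and \<open>t'\<close> for \<open>i > k\<close>. Subtracting \<open>t\<close>
  from the second summands puts the sums into \<open>A\<close> or
  \<open>A + (t' - t)\<close>.\<close>

lemma sumset_of_fatten:
  fixes A :: "nat set" and b c :: "nat \<Rightarrow> nat"
  assumes b: "strict_mono b" and c: "strict_mono c" and bc: "\<And>i k. b i + c k \<in> fatten l A"
  shows "\<exists>(B::nat set) (C::nat set) (k::int).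
           infinite B \<and> infinite C \<and> 0 \<notin> B \<and> 0 \<notin> C \<and>
           sumset (int ` B) (int ` C) \<subseteq> int ` A \<union> (\<lambda>a. a + k) ` (int ` A)"
proof -
  have "\<exists>t<l. \<exists>a\<in>A. b i + c k = a + t" for i k
    using bc[of i k] unfolding fatten_def by blast
  then obtain \<tau> where \<tau>: "\<And>i k. \<tau> i k < l" "\<And>i k. \<exists>a\<in>A. b i + c k = a + \<tau> i k"
    by metis
  \<comment> \<open>Both shifts of an unordered pair are packed as base-\<open>l\<close> digits into
    one colour below \<open>l * l\<close>.\<close>
  define f where "f P = \<tau> (Min P) (Max P) * l + \<tau> (Max P) (Min P)" for P
  have f_less: "f P < l * l" for P
  proof -
    have "f P < (\<tau> (Min P) (Max P) + 1) * l"
      using \<tau>(1) by (simp add: f_def)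
    also have "\<dots> \<le> l * l"
      using \<tau>(1) by (intro mult_le_mono1) (simp add: Suc_le_eq)
    finally show ?thesis .
  qed
  \<comment> \<open>Indices above \<open>l\<close> give \<open>c k \<ge> k > l > t\<close> and
    \<open>b i > 0\<close>, so \<open>B\<close> and \<open>C\<close> consist of positive
    numbers.\<close>
  have "\<forall>i\<in>{l<..}. \<forall>k\<in>{l<..}. i \<noteq> k \<longrightarrow> f {i, k} < l * l"
    using f_less by simp
  from Ramsey2[OF infinite_Ioi this]
  obtain Y q where Y: "Y \<subseteq> {l<..}" "infinite Y" "\<forall>i\<in>Y. \<forall>k\<in>Y. i \<noteq> k \<longrightarrow> f {i, k} = q"
    by (elim exE conjE)
  define t where "t = q div l"
  define t' where "t' = q mod l"
  have const: "\<tau> i k = t \<and> \<tau> k i = t'" if "i \<in> Y" "k \<in> Y" "i < k" for i k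
  proof -
    have "\<tau> i k * l + \<tau> k i = q"
      using Y(3)[rule_format, of i k] that by (simp add: f_def)
    then show ?thesis
      using \<tau>(1)[of k i] by (auto simp: t_def t'_def)
  qed
  define e where "e = enumerate Y"
  have e: "strict_mono e" and eY: "e n \<in> Y" for n
    unfolding e_def using Y(2) by (simp_all add: strict_mono_enumerate enumerate_in_set)
  have l_less: "l < e n" for n
    using eY Y(1) by blast
  have "t < l"
    using const[of "e 0" "e 1"] \<tau>(1) eY e by (metis less_numeral_extra(1) strict_mono_less)
  have t_less: "t < c (e n)" and b_pos: "0 < b (e n)" for n
    using l_less[of n] \<open>t < l\<close> seq_suble[OF c, of "e n"] seq_suble[OF b, of "e n"] by auto
  \<comment> \<open>Even and odd positions in \<open>Y\<close> avoid \<open>i = k\<close>, where the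
    colouring says nothing about the shift.\<close>
  define B where "B = range (\<lambda>n. b (e (2 * n)))"
  define C where "C = range (\<lambda>n. c (e (2 * n + 1)) - t)"
  have "inj (\<lambda>n. b (e (2 * n)))"
    using strict_mono_eq[OF b] strict_mono_eq[OF e] by (auto intro!: injI)
  then have "infinite B"
    unfolding B_def by (rule range_inj_infinite)
  have "inj (\<lambda>n. c (e (2 * n + 1)) - t)"
  proof (rule injI)
    fix m n assume "c (e (2 * m + 1)) - t = c (e (2 * n + 1)) - t"
    then have "c (e (2 * m + 1)) = c (e (2 * n + 1))"
      using t_less by (meson eq_diff_iff less_imp_le)
    then show "m = n"
      using strict_mono_eq[OF c] strict_mono_eq[OF e] by simp
  qed
  then have "infinite C"
    unfolding C_def by (rule range_inj_infinite)
  have "sumset (int ` B) (int ` C) \<subseteq> int ` A \<union> (\<lambda>a. a + (int t' - int t)) ` (int ` A)"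
  proof
    fix z assume "z \<in> sumset (int ` B) (int ` C)"
    then obtain m n where z: "z = int (b (e (2 * m))) + int (c (e (2 * n + 1)) - t)"
      by (auto simp: sumset_def B_def C_def)
    define i k where "i = e (2 * m)" and "k = e (2 * n + 1)"
    obtain a where a: "a \<in> A" "b i + c k = a + \<tau> i k"
      using \<tau>(2) by blast
    have "t < c k"
      unfolding k_def by (rule t_less)
    then have z': "z = int a + int (\<tau> i k) - int t"
      using z a(2) unfolding i_def[symmetric] k_def[symmetric] by linarith
    have "2 * m \<noteq> 2 * n + 1" by presburger
    then have "i \<noteq> k"
      unfolding i_def k_def using strict_mono_eq[OF e] by blast
    moreover have "i \<in> Y" "k \<in> Y"
      by (simp_all add: i_def k_def eY)
    ultimately have "\<tau> i k = t \<or> \<tau> i k = t'"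
      using const[of i k] const[of k i] by (cases i k rule: linorder_cases) auto
    then show "z \<in> int ` A \<union> (\<lambda>a. a + (int t' - int t)) ` (int ` A)"
      using z' a(1) by auto
  qed
  moreover have "0 \<notin> B" "0 \<notin> C"
    using b_pos t_less by (auto simp: B_def C_def) (metis less_nat_zero_code, metis not_le)
  ultimately show ?thesis
    using \<open>infinite B\<close> \<open>infinite C\<close> by blast
qed

section \<open>Choice of the parameters and assembly\<close>

theorem theorem1p1:
  fixes A :: "nat set"
  assumes "0 \<notin> A"
    and "banach_density A > 0"
  shows "\<exists>(B::nat set) (C::nat set) (k::int).
           infinite B \<and> infinite C \<and> 0 \<notin> B \<and> 0 \<notin> C \<and>
           sumset (int ` B) (int ` C) \<subseteq> int ` A \<union> (\<lambda>a. a + k) ` (int ` A)"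
proof -
  define \<alpha> where "\<alpha> = banach_density A"
  have "\<alpha> > 0"
    using assms(2) by (simp add: \<alpha>_def)
  have ev: "\<forall>\<^sub>F n in sequentially. window_max A n \<le> (\<alpha> + \<epsilon>) * n" if "\<epsilon> > 0" for \<epsilon>
    unfolding \<alpha>_def by (rule window_max_eventually_le[OF assms(1) that])
  \<comment> \<open>Makes \<open>\<alpha> - \<delta>\<close> and \<open>\<alpha> + \<delta>\<close>
    the factors \<open>9 / 10 * \<alpha>\<close> and \<open>11 / 10 * \<alpha>\<close> of
    \<open>fatten_dense\<close>.\<close>
  define \<delta> where "\<delta> = \<alpha> / 10"
  have "\<delta> > 0"
    using \<open>\<alpha> > 0\<close> by (simp add: \<delta>_def)
  obtain l where l: "l > 0" "window_max A l \<le> (\<alpha> + \<delta>) * l"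
    using eventually_conj[OF eventually_gt_at_top[of 0] ev[OF \<open>\<delta> > 0\<close>]]
    by (auto dest!: eventually_happens'[OF sequentially_bot])
  \<comment> \<open>The lengths exceed \<open>i\<close> to be unbounded, exceed
    \<open>40 * l / (3 * \<alpha>)\<close> for \<open>fatten_dense\<close>, and carry the summable
    errors needed for the averaging.\<close>
  have "\<exists>n>max i (nat \<lceil>40 * real l / (3 * \<alpha>)\<rceil>). window_max A n \<le> (\<alpha> + \<delta> / 2 ^ (i + 2)) * n" for i
  proof -
    have "\<delta> / 2 ^ (i + 2) > 0"
      using \<open>\<delta> > 0\<close> by simp
    from eventually_happens'[OF sequentially_bot eventually_conj[OF eventually_gt_at_top ev[OF this]]]
    show ?thesis by blast
  qed
  then obtain L where L: "\<And>i. max i (nat \<lceil>40 * real l / (3 * \<alpha>)\<rceil>) < L i"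
      "\<And>i. window_max A (L i) \<le> (\<alpha> + \<delta> / 2 ^ (i + 2)) * L i"
    by metis
  have L_large: "i < L i" "40 * real l \<le> 3 * \<alpha> * L i" for i
  proof -
    show "i < L i"
      using L(1)[of i] by simp
    have "40 * real l / (3 * \<alpha>) \<le> L i"
      using L(1)[of i] by linarith
    then show "40 * real l \<le> 3 * \<alpha> * L i"
      using \<open>\<alpha> > 0\<close> by (simp add: divide_le_eq mult.commute)
  qed
  have dense: "\<alpha> * n \<le> window_max A n" for n
    unfolding \<alpha>_def by (rule window_max_ge_density[OF assms(1)])
  have "\<forall>i. \<exists>m. card (A \<inter> {m..<m + L i}) = window_max A (L i)"
    using window_max_attained by blast
  then obtain x where x: "\<And>i. card (A \<inter> {x i..<x i + L i}) = window_max A (L i)"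
    by metis
  have "\<exists>c\<ge>c0. \<forall>i<N. (\<alpha> - \<delta>) * L i \<le> card (A \<inter> {c + x i..<c + x i + L i})" for c0 N
    using \<open>\<alpha> > 0\<close> \<open>\<delta> > 0\<close> le_less_trans[OF le0 L_large(1)]
    by (intro exists_good_translate dense L(2)) simp_all
  from exists_translate_limit[of "\<alpha> - \<delta>", OF this]
  obtain c R where c: "strict_mono c" "\<And>y. \<forall>\<^sub>F n in sequentially. c n + y \<in> A \<longleftrightarrow> y \<in> R"
      and R: "\<And>i. (\<alpha> - \<delta>) * L i \<le> card (R \<inter> {x i..<x i + L i})"
    by blast
  have windowA: "card (A \<inter> {m..<m + l}) \<le> 11 / 10 * \<alpha> * l" for m
    using window_max_upper[of A m l] l(2) by (simp add: \<delta>_def)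
  \<comment> \<open>Every window of \<open>R\<close> is a copy of a window of \<open>A\<close>, so
    the upper bound carries over.\<close>
  have windowR: "card (R \<inter> {m..<m + l}) \<le> 11 / 10 * \<alpha> * l" for m
    using eventually_happens'[OF sequentially_bot translate_limit_window[OF c(2), of m l]] windowA
    by metis
  define J where "J i = {x i..<x i + L i}" for i
  have J: "finite (J i) \<and> J i \<noteq> {}" "card (J i) = L i" for i
    using L_large(1)[of i] by (simp_all add: J_def)
  have denseA: "3 / 4 * L i \<le> card (fatten l A \<inter> J i)" for i
  proof -
    have "9 / 10 * \<alpha> * L i \<le> \<alpha> * L i"
      using \<open>\<alpha> > 0\<close> by simp
    also have "\<dots> \<le> card (A \<inter> {x i..<x i + L i})"
      using dense[of "L i"] by (simp add: x)
    finally show ?thesis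
      unfolding J_def by (rule fatten_dense[OF \<open>\<alpha> > 0\<close> l(1) windowA _ L_large(2)])
  qed
  have denseR: "3 / 4 * L i \<le> card (fatten l R \<inter> J i)" for i
    unfolding J_def using R[of i]
    by (intro fatten_dense[OF \<open>\<alpha> > 0\<close> l(1) windowR _ L_large(2)]) (simp add: \<delta>_def)
  define E where "E j = {b \<in> fatten l R. b + c j \<in> fatten l A}" for j
  \<comment> \<open>Two sets of density 3/4 in \<open>J i\<close> overlap in density at least 1/2;
    the translation costs at most \<open>c j\<close>, which is below \<open>L i / 4\<close> once
    \<open>i \<ge> 4 * c j\<close>.\<close>
  have "\<forall>\<^sub>F i in sequentially. 1 / 4 * card (J i) \<le> card (J i \<inter> E j)" for j
    using eventually_ge_at_top[of "4 * c j"]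
  proof eventually_elim
    case (elim i)
    let ?H = "{b \<in> J i. b + c j \<in> fatten l A}"
    have "card (fatten l A \<inter> J i) \<le> c j + card ?H"
      using card_translate_window[of "fatten l A" "x i" "L i" "c j" 0] by (simp add: J_def)
    moreover have "card (fatten l R \<inter> J i) + card ?H =
        card (fatten l R \<inter> J i \<union> ?H) + card (J i \<inter> E j)"
    proof -
      have "fatten l R \<inter> J i \<inter> ?H = J i \<inter> E j"
        by (auto simp: E_def)
      moreover have "finite (fatten l R \<inter> J i)" "finite ?H"
        using J(1) by simp_all
      ultimately show ?thesis
        using card_Un_Int[of "fatten l R \<inter> J i" ?H] by simp
    qed
    moreover have "card (fatten l R \<inter> J i \<union> ?H) \<le> L i"
      unfolding J(2)[symmetric] using J by (intro card_mono) auto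
    ultimately show ?case
      using denseA[of i] denseR[of i] elim L_large(1)[of i] J(2)[of i] by linarith
  qed
  then obtain r :: "nat \<Rightarrow> nat" where "strict_mono r"
      and r: "\<And>n. \<exists>\<eta>>(0::real). \<exists>\<^sub>F i in sequentially. \<eta> * card (J i) \<le> card (J i \<inter> (\<Inter>k<n. E (r k)))"
    using intersective_subsequence[of J "1 / 4" E] J(1) by auto
  have "\<forall>\<^sub>F j in sequentially. b + c (r j) \<in> fatten l A" if "b \<in> fatten l R" for b
  proof -
    obtain y t where y: "b = y + t" "y \<in> R" "t < l"
      using \<open>b \<in> fatten l R\<close> by (auto simp: fatten_def)
    show ?thesis
      using eventually_subseq[OF \<open>strict_mono r\<close> c(2)[of y]]
    proof eventually_elim
      case (elim j)
      then have "c (r j) + y \<in> A"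
        using y by simp
      then show ?case
        unfolding fatten_def using y by (intro CollectI exI[of _ "c (r j) + y"] exI[of _ t]) simp
    qed
  qed
  \<comment> \<open>The set contains a fixed positive proportion of arbitrarily long
    \<open>J i\<close>.\<close>
  moreover have "infinite {b \<in> fatten l R. \<forall>j<m. b + c (r j) \<in> fatten l A}" (is "infinite ?G") for m
  proof
    assume fin: "finite ?G"
    \<comment> \<open>\<open>Suc m\<close> keeps the family nonempty for \<open>m = 0\<close>, so
      that the intersection lies in \<open>fatten l R\<close>.\<close>
    obtain \<eta> :: real where \<eta>: "\<eta> > 0"
        "\<exists>\<^sub>F i in sequentially. \<eta> * card (J i) \<le> card (J i \<inter> (\<Inter>k<Suc m. E (r k)))"
      using r by blast
    define i0 where "i0 = nat \<lceil>card ?G / \<eta>\<rceil>"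
    obtain i where i: "i \<ge> i0" "\<eta> * card (J i) \<le> card (J i \<inter> (\<Inter>k<Suc m. E (r k)))"
      using \<eta>(2) unfolding frequently_sequentially by blast
    have "card (J i \<inter> (\<Inter>k<Suc m. E (r k))) \<le> card ?G"
      using fin by (intro card_mono) (auto simp: E_def)
    then have "real (L i) \<le> card ?G / \<eta>"
      using i(2) \<eta>(1) J(2) by (simp add: le_divide_eq mult.commute)
    then show False
      using i(1) L_large(1)[of i] unfolding i0_def by linarith
  qed
  ultimately obtain b j :: "nat \<Rightarrow> nat" where "strict_mono b" "strict_mono j" "\<And>i k. b i + c (r (j k)) \<in> fatten l A"
    using interleaved_sequences[of "fatten l R" "\<lambda>b j. b + c (r j) \<in> fatten l A"] by blast
  moreover have "strict_mono (\<lambda>k. c (r (j k)))"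
    using c(1) \<open>strict_mono r\<close> \<open>strict_mono j\<close> by (simp add: strict_mono_def)
  ultimately show ?thesis
    by (intro sumset_of_fatten)
qed

end
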